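(* Let $k\ge1$ and $n>k$ be integers, and let $\underline\tau,\overline\tau\in(0,1]$ with $\underline\tau<\overline\tau$. Then there exists $\tau\in[\underline\tau,\overline\tau]$ such that $$\sum_{i=1}^n\sum_{l=1}^k\min\{y^l_i(\tau),q\,x^l_i(\tau)\}\ \ge\ \frac12\left(\sum_{i=1}^n\sum_{l=1}^k\min\{y^l_i(\underline\tau),q\,x^l_i(\underline\tau)\}+\sum_{i=1}^n\sum_{l=1}^k\min\{y^l_i(\overline\tau),q\,x^l_i(\overline\tau)\}\right)$$ holds for every $q\in(0,1]$.
   Context: For $t\in(0,1]$, the real arrays $(x^l_i(t))$, $(y^l_i(t))$, indexed by $i\in\{1,\dots,n\}$ and $l\in\{1,\dots,k\}$, are defined by: $y^l_i(t)=t\,x^l_i(t)$ for all $i,l$; $x^k_1(t)=1$; $x^l_1(t)=0$ for $l<k$; and $x^l_i(t)=x^l_{i-1}(t)-y^l_{i-1}(t)+y^{l+1}_{i-1}(t)$ for all $i>1$ and $l\in\{1,\dots,k\}$, with the convention $y^{k+1}_{i}(t)=0$. (Thus $x^l_i(t)$ is the probability of having exactly $l$ slots left when agent $i$ arrives, if one starts with $k$ slots and each agent independently takes a slot with probability $t$ while slots remain.) *)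

theory Defs
  imports "HOL-Analysis.Analysis"
begin

text \<open>
  The arrays \<open>x\<^sup>l\<^sub>i(t)\<close> and \<open>y\<^sup>l\<^sub>i(t)\<close> are \<open>slots_x k t l i\<close> and \<open>slots_y k t l i\<close>,
  with agents \<open>i \<in> {1..n}\<close> and slots left \<open>l \<in> {1..k}\<close>. The recursion does not mention
  \<open>n\<close>, so the arrays are defined for all \<open>i \<ge> 1\<close>; the values at \<open>i = 0\<close>, \<open>l = 0\<close> and
  \<open>l > k\<close> carry no meaning, apart from the convention \<open>y\<^sup>k\<^sup>+\<^sup>1\<^sub>i(t) = 0\<close>, which is the
  conditional in the last equation and in \<open>slots_y\<close>.
\<close>

fun slots_x :: "nat \<Rightarrow> real \<Rightarrow> nat \<Rightarrow> nat \<Rightarrow> real" where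
  "slots_x k t l 0 = 0"
| "slots_x k t l (Suc 0) = (if l = k then 1 else 0)"
| "slots_x k t l (Suc (Suc i)) =
     slots_x k t l (Suc i) - t * slots_x k t l (Suc i)
       + (if l + 1 \<le> k then t * slots_x k t (l + 1) (Suc i) else 0)"

definition slots_y :: "nat \<Rightarrow> real \<Rightarrow> nat \<Rightarrow> nat \<Rightarrow> real" where
  "slots_y k t l i = (if l \<le> k then t * slots_x k t l i else 0)"

lemma slots_y_eq: "l \<in> {1..k} \<Longrightarrow> slots_y k t l i = t * slots_x k t l i"
  by (simp add: slots_y_def)

lemma slots_y_convention: "slots_y k t (k + 1) i = 0"
  by (simp add: slots_y_def)

lemma slots_x_first: "slots_x k t k 1 = 1" "l < k \<Longrightarrow> slots_x k t l 1 = 0"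
  by simp_all

lemma slots_x_step:
  assumes "i > 1" "l \<in> {1..k}"
  shows "slots_x k t l i =
    slots_x k t l (i - 1) - slots_y k t l (i - 1) + slots_y k t (l + 1) (i - 1)"
proof -
  obtain j where "i = Suc (Suc j)"
    using assms(1) by (metis One_nat_def less_imp_Suc_add add_Suc_right add_0 add_Suc)
  with assms(2) show ?thesis by (simp add: slots_y_def)
qed

end

theory Submission
  imports Defs
begin

text \<open>
  Since \<open>y = t x\<close>, the double sum at \<open>t\<close> is \<open>min t q * S t\<close> with \<open>S t\<close> the sum of all
  \<open>x\<close>, and \<open>t * S t\<close> is the expected number of taken slots, i.e. the mean of \<open>min X k\<close> for
  \<open>X\<close> binomial with parameters \<open>n, t\<close>. If \<open>1 / S\<close> is convex, then the weighted mean
  \<open>\<tau> = (a * S a + b * S b) / (S a + S b)\<close> of the end points satisfies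
  \<open>S \<tau> \<ge> (S a + S b) / 2\<close>, hence also \<open>\<tau> * S \<tau> \<ge> (a * S a + b * S b) / 2\<close>, and these two
  inequalities settle all \<open>q\<close>. Convexity of \<open>1 / S\<close> is
  \<open>2 * P(X > k) * E(X; X \<le> k) \<le> E(min X k) * (k + 1) * P(X = k + 1)\<close>, which follows by comparing
  both tails of the binomial distribution with geometric series.
\<close>

section \<open>Bernstein polynomials\<close>

lemma Suc_times_binomial_Suc_right:
  "real (Suc j) * real (n choose Suc j) = real (n - j) * real (n choose j)"
  by (metis binomial_absorb_comp binomial_absorption of_nat_mult)

lemma Bernstein_eq_0: "n < j \<Longrightarrow> Bernstein n j t = 0"
  by (simp add: Bernstein_def)

lemma Bernstein_Suc_0: "Bernstein (Suc n) 0 t = (1 - t) * Bernstein n 0 t"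
  by (simp add: Bernstein_def)

lemma Bernstein_Suc_Suc:
  "Bernstein (Suc n) (Suc j) t = (1 - t) * Bernstein n (Suc j) t + t * Bernstein n j t"
proof (cases "j < n")
  case True
  then have "n - j = Suc (n - Suc j)" by simp
  then show ?thesis by (simp add: Bernstein_def algebra_simps)
next
  case False
  then show ?thesis
    by (cases "j = n") (simp_all add: Bernstein_def binomial_eq_0)
qed

text \<open>Ratio of consecutive binomial probabilities, cleared of denominators so that
  \<open>t = 1\<close> and \<open>j \<ge> n\<close> are covered too.\<close>

lemma Bernstein_ratio:
  "(1 - t) * (real (Suc j) * Bernstein n (Suc j) t) = real (n - j) * t * Bernstein n j t"
proof (cases "j < n")
  case True
  then have n: "n - j = Suc (n - Suc j)" by simp
  have "(1 - t) * t ^ Suc j * (1 - t) ^ (n - Suc j) * (real (Suc j) * real (n choose Suc j))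
    = (1 - t) * t ^ Suc j * (1 - t) ^ (n - Suc j) * (real (n - j) * real (n choose j))"
    by (simp only: Suc_times_binomial_Suc_right)
  then show ?thesis unfolding Bernstein_def n by (simp only: power_Suc mult_ac)
qed (simp add: Bernstein_eq_0)

text \<open>Up to the factor \<open>1 / t\<close>, the derivative is a difference of consecutive
  values of \<open>real j * Bernstein n j t\<close>, which prepares summation by parts.\<close>

lemma DERIV_Bernstein:
  assumes "t \<noteq> 0"
  shows "(Bernstein n j has_real_derivative
    (real j * Bernstein n j t - real (Suc j) * Bernstein n (Suc j) t) / t) (at t)"
proof -
  have "(Bernstein n j has_real_derivative real (n choose j) *
    (real j * t ^ (j - 1) * (1 - t) ^ (n - j) - real (n - j) * t ^ j * (1 - t) ^ (n - j - 1))) (at t)"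
    unfolding Bernstein_def [abs_def]
    by (auto intro!: derivative_eq_intros simp: algebra_simps)
  moreover have "t * (real (n choose j) *
    (real j * t ^ (j - 1) * (1 - t) ^ (n - j) - real (n - j) * t ^ j * (1 - t) ^ (n - j - 1)))
    = real j * Bernstein n j t - real (Suc j) * Bernstein n (Suc j) t"
  proof -
    have p: "t * (real j * t ^ (j - 1)) = real j * t ^ j"
      by (cases j) auto
    have "t * (real (n choose j) *
        (real j * t ^ (j - 1) * (1 - t) ^ (n - j) - real (n - j) * t ^ j * (1 - t) ^ (n - j - 1)))
      = real (n choose j) * (t * (real j * t ^ (j - 1))) * (1 - t) ^ (n - j)
        - t ^ Suc j * (1 - t) ^ (n - Suc j) * (real (n - j) * real (n choose j))"
      by (simp add: algebra_simps)
    then show ?thesis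
      unfolding p Suc_times_binomial_Suc_right [symmetric] Bernstein_def by (simp add: mult_ac)
  qed
  ultimately show ?thesis using assms
    by (metis nonzero_mult_div_cancel_left)
qed

text \<open>Summation by parts: only increments of \<open>f\<close> survive. For the capped identity
  they vanish from \<open>k\<close> on, for the indicator of \<open>k < j\<close> everywhere but at
  \<open>k\<close>.\<close>

lemma DERIV_sum_Bernstein:
  assumes "t \<noteq> 0"
  shows "((\<lambda>t. \<Sum>j\<le>n. f j * Bernstein n j t) has_real_derivative
    (\<Sum>j\<le>n. (f (Suc j) - f j) * (real (Suc j) * Bernstein n (Suc j) t)) / t) (at t)"
proof -
  \<comment> \<open>The added top term is zero since \<open>Bernstein n (Suc n) t = 0\<close>; in
    the shift the bottom term is lost through its factor \<open>real j\<close>.\<close>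
  have "(\<Sum>j\<le>n. f j * (real j * Bernstein n j t))
      = (\<Sum>j\<le>Suc n. f j * (real j * Bernstein n j t))"
    by (simp add: Bernstein_eq_0)
  also have "\<dots> = (\<Sum>j\<le>n. f (Suc j) * (real (Suc j) * Bernstein n (Suc j) t))"
    by (subst sum.atMost_Suc_shift) simp
  finally have eq: "(\<Sum>j\<le>n. f j * ((real j * Bernstein n j t - real (Suc j) * Bernstein n (Suc j) t) / t))
    = (\<Sum>j\<le>n. (f (Suc j) - f j) * (real (Suc j) * Bernstein n (Suc j) t)) / t"
    by (simp only: left_diff_distrib right_diff_distrib sum_subtractf times_divide_eq_right
        sum_divide_distrib [symmetric])
  show ?thesis
    unfolding eq [symmetric] by (intro DERIV_sum DERIV_cmult DERIV_Bernstein assms)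
qed

section \<open>Truncated moments of the binomial distribution\<close>

definition capped_mean :: "nat \<Rightarrow> nat \<Rightarrow> real \<Rightarrow> real" where
  "capped_mean n k t = (\<Sum>j\<le>n. real (min j k) * Bernstein n j t)"

definition upper_tail :: "nat \<Rightarrow> nat \<Rightarrow> real \<Rightarrow> real" where
  "upper_tail n k t = (\<Sum>j\<le>n. of_bool (k < j) * Bernstein n j t)"

text \<open>This is \<open>E(X; X \<le> k)\<close>; the shifted index omits the zero term and
  matches the sum that summation by parts produces.\<close>

definition lower_mean :: "nat \<Rightarrow> nat \<Rightarrow> real \<Rightarrow> real" where
  "lower_mean n k t = (\<Sum>j<k. real (Suc j) * Bernstein n (Suc j) t)"

lemma capped_mean_eq:
  assumes "k < n"
  shows "capped_mean n k t = lower_mean n k t + real k * upper_tail n k t"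
proof -
  have "lower_mean n k t = (\<Sum>j\<le>k. real j * Bernstein n j t)"
    unfolding lower_mean_def by (simp add: sum.atMost_shift)
  also have "\<dots> = (\<Sum>j\<le>n. of_bool (j \<le> k) * (real j * Bernstein n j t))"
    using assms by (intro sum.mono_neutral_cong_left) auto
  finally show ?thesis
    unfolding capped_mean_def upper_tail_def
    by (auto simp only: sum_distrib_left sum.distrib [symmetric] intro!: sum.cong) auto
qed

lemma DERIV_capped_mean:
  assumes "t \<noteq> 0" "k < n"
  shows "(capped_mean n k has_real_derivative lower_mean n k t / t) (at t)"
proof -
  have "(\<Sum>j\<le>n. (real (min (Suc j) k) - real (min j k)) * (real (Suc j) * Bernstein n (Suc j) t))
    = lower_mean n k t"
    unfolding lower_mean_def using assms by (intro sum.mono_neutral_cong_right) auto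
  then show ?thesis
    using DERIV_sum_Bernstein [OF assms(1), where f = "\<lambda>j. real (min j k)" and n = n]
    unfolding capped_mean_def [abs_def] by simp
qed

lemma DERIV_upper_tail:
  assumes "t \<noteq> 0" "k < n"
  shows "(upper_tail n k has_real_derivative real (Suc k) * Bernstein n (Suc k) t / t) (at t)"
proof -
  have "(\<Sum>j\<le>n. (of_bool (k < Suc j) - of_bool (k < j)) * (real (Suc j) * Bernstein n (Suc j) t))
    = (\<Sum>j\<in>{k}. real (Suc j) * Bernstein n (Suc j) t)"
    using assms by (intro sum.mono_neutral_cong_right) auto
  then show ?thesis
    using DERIV_sum_Bernstein [OF assms(1), where f = "\<lambda>j. of_bool (k < j)" and n = n]
    unfolding upper_tail_def [abs_def] by simp
qed

text \<open>Condition on the additional trial: it raises \<open>min X k\<close> by one exactly when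
  it succeeds and \<open>X < k\<close>.\<close>

lemma capped_mean_Suc:
  "capped_mean (Suc n) k t = capped_mean n k t + t * (\<Sum>j<k. Bernstein n j t)"
proof -
  have "capped_mean (Suc n) k t
      = (\<Sum>j\<le>n. real (min (Suc j) k) * ((1 - t) * Bernstein n (Suc j) t + t * Bernstein n j t))"
    unfolding capped_mean_def by (subst sum.atMost_Suc_shift) (simp add: Bernstein_Suc_Suc)
  also have "\<dots> = (1 - t) * (\<Sum>j\<le>n. real (min (Suc j) k) * Bernstein n (Suc j) t)
      + t * (\<Sum>j\<le>n. real (min (Suc j) k) * Bernstein n j t)"
    by (simp only: sum_distrib_left sum.distrib [symmetric]) (simp add: algebra_simps)
  also have "(\<Sum>j\<le>n. real (min (Suc j) k) * Bernstein n (Suc j) t)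
      = (\<Sum>j\<le>Suc n. real (min j k) * Bernstein n j t)"
    by (subst sum.atMost_Suc_shift) simp
  also have "\<dots> = capped_mean n k t"
    by (simp add: capped_mean_def Bernstein_eq_0)
  also have "(\<Sum>j\<le>n. real (min (Suc j) k) * Bernstein n j t)
      = capped_mean n k t + (\<Sum>j\<le>n. of_bool (j < k) * Bernstein n j t)"
    unfolding capped_mean_def sum.distrib [symmetric]
    by (intro sum.cong) (auto simp: algebra_simps min_def)
  also have "(\<Sum>j\<le>n. of_bool (j < k) * Bernstein n j t) = (\<Sum>j<k. Bernstein n j t)"
    by (intro sum.mono_neutral_cong) (auto simp: Bernstein_eq_0)
  finally show ?thesis by (simp add: algebra_simps)
qed

lemma capped_mean_eq_sum: "capped_mean n k t = t * (\<Sum>i<n. \<Sum>j<k. Bernstein i j t)"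
  by (induction n) (simp_all add: capped_mean_Suc distrib_left, simp add: capped_mean_def)

section \<open>Geometric comparison of the two tails\<close>

lemma lower_mean_nonneg: "0 \<le> t \<Longrightarrow> t \<le> 1 \<Longrightarrow> 0 \<le> lower_mean n k t"
  by (simp add: lower_mean_def sum_nonneg Bernstein_nonneg)

lemma upper_tail_nonneg: "0 \<le> t \<Longrightarrow> t \<le> 1 \<Longrightarrow> 0 \<le> upper_tail n k t"
  by (simp add: upper_tail_def sum_nonneg Bernstein_nonneg)

text \<open>For \<open>j < k\<close>, \<open>Bernstein_ratio\<close> with
  \<open>n - Suc j \<ge> n - k\<close> bounds each term by its successor. Shifting the index splits
  off the boundary term at \<open>k\<close>; the other weights are at most
  \<open>k - 1\<close>.\<close>

lemma lower_mean_le: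
  assumes "0 \<le> t" "t \<le> 1" "1 \<le> k"
  shows "real (n - k) * t * lower_mean n k t
    \<le> (1 - t) * (real k * (real (Suc k) * Bernstein n (Suc k) t) + (real k - 1) * lower_mean n k t)"
proof -
  define r where "r j = real (Suc j) * Bernstein n (Suc j) t" for j
  have r: "0 \<le> r j" for j using assms by (simp add: r_def Bernstein_nonneg)
  have "real (n - k) * t * r j \<le> (1 - t) * (real (Suc j) * r (Suc j))" if "j < k" for j
  proof -
    have "real (n - k) * (t * r j) \<le> real (n - Suc j) * (t * r j)"
      using that assms r by (intro mult_right_mono) auto
    also have "\<dots> = real (Suc j) * (real (n - Suc j) * t * Bernstein n (Suc j) t)"
      by (simp add: r_def)
    also have "\<dots> = (1 - t) * (real (Suc j) * r (Suc j))"
      unfolding r_def Bernstein_ratio [symmetric] by (simp only: mult_ac)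
    finally show ?thesis by (simp add: mult_ac)
  qed
  then have "real (n - k) * t * (\<Sum>j<k. r j) \<le> (\<Sum>j<k. (1 - t) * (real (Suc j) * r (Suc j)))"
    unfolding sum_distrib_left by (intro sum_mono) auto
  also have "\<dots> = (1 - t) * (\<Sum>j<Suc k. real j * r j)"
    by (subst sum.lessThan_Suc_shift) (simp add: sum_distrib_left)
  also have "\<dots> \<le> (1 - t) * (real k * r k + (real k - 1) * (\<Sum>j<k. r j))"
  proof -
    have "(\<Sum>j<k. real j * r j) \<le> (real k - 1) * (\<Sum>j<k. r j)"
      unfolding sum_distrib_left using r by (intro sum_mono mult_right_mono) auto
    then show ?thesis using assms by (intro mult_left_mono) auto
  qed
  finally show ?thesis by (simp add: lower_mean_def r_def)
qed

text \<open>For \<open>j > k\<close>, \<open>j + 1 \<ge> k + 2\<close> and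
  \<open>n - j \<le> n - k\<close> give a uniform bound on the ratio of consecutive terms; removing
  the first term shifts the tail by one.\<close>

lemma upper_tail_le:
  assumes "0 \<le> t" "t \<le> 1" "k < n"
  shows "(1 - t) * (real k + 2) * (upper_tail n k t - Bernstein n (Suc k) t)
    \<le> real (n - k) * t * upper_tail n k t"
proof -
  have T: "upper_tail n k t = (\<Sum>j\<in>{Suc k..n}. Bernstein n j t)"
    unfolding upper_tail_def by (intro sum.mono_neutral_cong_right) auto
  also have "\<dots> = (\<Sum>j\<in>{Suc k..Suc n}. Bernstein n j t)"
    using assms by (simp add: Bernstein_eq_0)
  also have "\<dots> = Bernstein n (Suc k) t + (\<Sum>j\<in>{Suc k..n}. Bernstein n (Suc j) t)"
    using assms by (subst sum.atLeast_Suc_atMost) (auto simp: sum.shift_bounds_cl_Suc_ivl simp del: sum.cl_ivl_Suc)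
  finally have "upper_tail n k t - Bernstein n (Suc k) t = (\<Sum>j\<in>{Suc k..n}. Bernstein n (Suc j) t)"
    by simp
  moreover have "(1 - t) * (real k + 2) * Bernstein n (Suc j) t \<le> real (n - k) * t * Bernstein n j t"
    if "j \<in> {Suc k..n}" for j
  proof -
    have b: "0 \<le> Bernstein n i t" for i using assms by (simp add: Bernstein_nonneg)
    have "(1 - t) * ((real k + 2) * Bernstein n (Suc j) t)
        \<le> (1 - t) * (real (Suc j) * Bernstein n (Suc j) t)"
      using that assms b by (intro mult_left_mono mult_right_mono) auto
    also have "\<dots> = real (n - j) * t * Bernstein n j t" by (rule Bernstein_ratio)
    also have "\<dots> \<le> real (n - k) * t * Bernstein n j t"
      using that assms b by (intro mult_right_mono) auto
    finally show ?thesis by (simp add: mult_ac)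
  qed
  ultimately show ?thesis
    unfolding T sum_distrib_left by (simp only: sum_distrib_left sum_mono)
qed

text \<open>
  In the application \<open>v\<close> is \<open>(n - k) * t / (1 - t)\<close>, and \<open>K\<close>, \<open>A\<close>, \<open>T\<close>, \<open>r\<close> are \<open>k\<close>, \<open>lower_mean\<close>,
  \<open>upper_tail\<close> and \<open>(k + 1) * P(X = k + 1)\<close>.
\<close>

lemma tails_arith:
  fixes K A T r v :: real
  assumes K: "1 \<le> K" and nn: "0 \<le> A" "0 \<le> T" "0 \<le> r" "0 \<le> v"
    and T: "(K + 1) * (K + 2 - v) * T \<le> (K + 2) * r"
    and A: "(v - K + 1) * A \<le> K * r"
  shows "2 * T * A \<le> (A + K * T) * r"
proof -
  consider "v \<ge> K + 1" | "v \<le> K - 1" | "K - 1 < v" "v < K + 1" by linarith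
  then show ?thesis
  proof cases
    case 1
    \<comment> \<open>The bound on \<open>A\<close> gives \<open>2 * A \<le> K * r\<close>, which
      settles this case.\<close>
    then have "2 * A \<le> (v - K + 1) * A" using nn by (intro mult_right_mono) auto
    then have "T * (2 * A) \<le> T * (K * r)" using A nn by (intro mult_left_mono) auto
    moreover have "0 \<le> A * r" using nn by simp
    ultimately show ?thesis by (simp add: algebra_simps)
  next
    case 2
    \<comment> \<open>The bound on \<open>T\<close> gives \<open>2 * T \<le> r\<close>; the
      constants fit because \<open>K \<ge> 1\<close>.\<close>
    have "(K + 2) * 2 \<le> (K + 1) * 3" using K by simp
    also have "\<dots> \<le> (K + 1) * (K + 2 - v)" using 2 K by (intro mult_left_mono) auto
    finally have "(K + 2) * 2 * T \<le> (K + 1) * (K + 2 - v) * T" using nn by (intro mult_right_mono)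
    with T have "(K + 2) * (2 * T) \<le> (K + 2) * r" by (simp only: mult.assoc [symmetric] order.trans)
    then have "2 * T \<le> r" using K by simp
    then have "A * (2 * T) \<le> A * r" using nn by (intro mult_left_mono) auto
    moreover have "0 \<le> K * T * r" using nn K by simp
    ultimately show ?thesis by (simp add: algebra_simps)
  next
    case 3
    \<comment> \<open>Add the two bounds with weights \<open>A\<close> and
      \<open>(K + 2) * T\<close>: the coefficient of \<open>T * A\<close> becomes
      \<open>2 * (K + 2) + v\<close>.\<close>
    have "A * ((K + 1) * (K + 2 - v) * T) \<le> A * ((K + 2) * r)"
      using T nn by (intro mult_left_mono)
    moreover have "(K + 2) * T * ((v - K + 1) * A) \<le> (K + 2) * T * (K * r)"
      using A nn K by (intro mult_left_mono) auto
    moreover have "0 \<le> v * (T * A)" using nn by simp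
    ultimately have "(K + 2) * (2 * T * A) \<le> (K + 2) * ((A + K * T) * r)"
      by (simp add: algebra_simps)
    then show ?thesis using K by simp
  qed
qed

lemma lower_mean_upper_tail_le:
  assumes t: "0 < t" "t \<le> 1" and k: "1 \<le> k" "k < n"
  shows "2 * upper_tail n k t * lower_mean n k t
    \<le> capped_mean n k t * (real (Suc k) * Bernstein n (Suc k) t)"
proof -
  define A T P where "A = lower_mean n k t" and "T = upper_tail n k t" and "P = Bernstein n (Suc k) t"
  have nn: "0 \<le> A" "0 \<le> T" "0 \<le> P"
    using t by (simp_all add: A_def T_def P_def lower_mean_nonneg upper_tail_nonneg Bernstein_nonneg)
  have A: "real (n - k) * t * A \<le> (1 - t) * (real k * (real (Suc k) * P) + (real k - 1) * A)"
    using lower_mean_le [of t k n] t k by (simp add: A_def P_def)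
  have T: "(1 - t) * (real k + 2) * (T - P) \<le> real (n - k) * t * T"
    using upper_tail_le [of t k n] t k by (simp add: T_def P_def)
  have "2 * T * A \<le> (A + real k * T) * (real (Suc k) * P)"
  \<comment> \<open>At \<open>t = 1\<close> all mass sits at \<open>n > k\<close>, so the lower mean
    vanishes; otherwise division by \<open>1 - t\<close> is allowed.\<close>
  proof (cases "t = 1")
    case True
    then have "real (n - k) * A \<le> 0" using A by simp
    then have "A = 0" using k nn by (simp add: mult_le_0_iff)
    then show ?thesis using nn by simp
  next
    case False
    define v where "v = real (n - k) * t / (1 - t)"
    have t': "0 < 1 - t" using t False by simp
    then have v: "real (n - k) * t = (1 - t) * v" by (simp add: v_def)
    have "0 \<le> v" using t t' by (simp add: v_def)
    have "(1 - t) * (v * A) \<le> (1 - t) * (real k * (real (Suc k) * P) + (real k - 1) * A)"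
      using A unfolding v by (simp only: mult_ac)
    then have A': "v * A \<le> real k * (real (Suc k) * P) + (real k - 1) * A"
      using t' by (rule mult_left_le_imp_le)
    have "(1 - t) * ((real k + 2) * (T - P)) \<le> (1 - t) * (v * T)"
      using T unfolding v by (simp only: mult_ac)
    then have "(real k + 2) * (T - P) \<le> v * T"
      using t' by (rule mult_left_le_imp_le)
    then have "(real k + 1) * ((real k + 2) * (T - P)) \<le> (real k + 1) * (v * T)"
      by (intro mult_left_mono) auto
    then have T': "(real k + 1) * (real k + 2 - v) * T \<le> (real k + 2) * (real (Suc k) * P)"
      by (simp add: algebra_simps)
    show ?thesis
      using A' k nn \<open>0 \<le> v\<close> by (intro tails_arith [OF _ _ _ _ _ T']) (auto simp: algebra_simps)
  qed
  then show ?thesis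
    using k by (simp add: capped_mean_eq A_def T_def P_def)
qed

section \<open>The expected number of agents finding a free slot\<close>

definition slots_sum :: "nat \<Rightarrow> nat \<Rightarrow> real \<Rightarrow> real" where
  "slots_sum n k t = (\<Sum>i=1..n. \<Sum>l=1..k. slots_x k t l i)"

text \<open>While slots remain nobody has been turned away, so \<open>l \<ge> 1\<close> slots left
  after \<open>i\<close> agents means \<open>k - l\<close> successes in \<open>i\<close> independent
  trials.\<close>

lemma slots_x_eq_Bernstein: "l \<le> k \<Longrightarrow> slots_x k t l (Suc i) = Bernstein i (k - l) t"
proof (induction i arbitrary: l)
  case 0
  then show ?case by (auto simp: Bernstein_def)
next
  case (Suc i)
  show ?case
  proof (cases "l = k")
    case True
    then show ?thesis using Suc.IH [of l] by (simp add: Bernstein_Suc_0 algebra_simps)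
  next
    case False
    with Suc.prems have "k - l = Suc (k - Suc l)" "Suc l \<le> k" by auto
    then show ?thesis using Suc.IH [of l] Suc.IH [of "Suc l"] Suc.prems
      by (simp add: Bernstein_Suc_Suc algebra_simps)
  qed
qed

lemma slots_sum_eq: "slots_sum n k t = (\<Sum>i<n. \<Sum>j<k. Bernstein i j t)"
proof -
  have "(\<Sum>l=1..k. slots_x k t l (Suc i)) = (\<Sum>j<k. Bernstein i j t)" for i
    by (rule sum.reindex_bij_witness [where i = "\<lambda>j. k - j" and j = "\<lambda>l. k - l"])
      (auto simp: slots_x_eq_Bernstein)
  then show ?thesis
    unfolding slots_sum_def by (simp add: sum.atLeast1_atMost_eq)
qed

lemma capped_mean_eq_slots_sum: "capped_mean n k t = t * slots_sum n k t"
  by (simp add: capped_mean_eq_sum slots_sum_eq)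

lemma sum_min_slots:
  assumes "0 \<le> t" "t \<le> 1"
  shows "(\<Sum>i=1..n. \<Sum>l=1..k. min (slots_y k t l i) (q * slots_x k t l i))
    = min t q * slots_sum n k t"
  unfolding slots_sum_def sum_distrib_left
proof (intro sum.cong refl)
  fix i l assume i: "i \<in> {1..n}" and l: "l \<in> {1..k}"
  then obtain i' where "i = Suc i'" by (cases i) auto
  then have "0 \<le> slots_x k t l i"
    using l assms by (simp add: slots_x_eq_Bernstein Bernstein_nonneg)
  then show "min (slots_y k t l i) (q * slots_x k t l i) = min t q * slots_x k t l i"
    using l by (simp add: slots_y_eq min_mult_distrib_right)
qed

text \<open>The first agent surely finds a slot, so the sum is at least 1.\<close>

lemma slots_sum_pos:
  assumes "0 \<le> t" "t \<le> 1" "1 \<le> k" "1 \<le> n"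
  shows "0 < slots_sum n k t"
proof -
  have nn: "0 \<le> (\<Sum>j<k. Bernstein i j t)" for i
    using assms by (simp add: sum_nonneg Bernstein_nonneg)
  have "1 = Bernstein 0 0 t" by (simp add: Bernstein_def)
  also have "\<dots> \<le> (\<Sum>j<k. Bernstein 0 j t)"
    using assms by (intro member_le_sum) (auto simp: Bernstein_nonneg)
  also have "\<dots> \<le> (\<Sum>i<n. \<Sum>j<k. Bernstein i j t)"
    using assms nn by (intro member_le_sum [where f = "\<lambda>i. \<Sum>j<k. Bernstein i j t"]) auto
  finally show ?thesis by (simp add: slots_sum_eq)
qed

text \<open>The function is \<open>1 / slots_sum n k t\<close>, written through
  \<open>capped_mean\<close>, whose derivative is known.\<close>

lemma convex_divide_capped_mean:
  assumes k: "1 \<le> k" "k < n"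
  shows "convex_on {0<..1} (\<lambda>t. t / capped_mean n k t)"
proof -
  let ?G = "capped_mean n k" and ?T = "upper_tail n k" and ?A = "lower_mean n k"
    and ?r = "\<lambda>t. real (Suc k) * Bernstein n (Suc k) t"
  have G: "0 < ?G t" if "t \<in> {0<..1}" for t
    using that k by (simp add: capped_mean_eq_slots_sum slots_sum_pos)
  show ?thesis
  proof (rule f''_ge0_imp_convex)
    fix t :: real assume t: "t \<in> {0<..1}"
    then have "t \<noteq> 0" by simp
    note DG = DERIV_capped_mean [OF this k(2)] and DT = DERIV_upper_tail [OF this k(2)]
    have G0: "?G t \<noteq> 0" using G [OF t] by simp
    \<comment> \<open>The numerator is \<open>capped_mean - lower_mean\<close>, that is,
      \<open>k\<close> times the upper tail.\<close>
    have "((\<lambda>t. t / ?G t) has_real_derivative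
        (1 * ?G t - t * (?A t / t)) / (?G t * ?G t)) (at t)"
      by (intro DERIV_divide DERIV_ident DG G0)
    then show "((\<lambda>t. t / ?G t) has_real_derivative real k * ?T t / (?G t)\<^sup>2) (at t)"
      using \<open>t \<noteq> 0\<close> by (simp add: capped_mean_eq [OF k(2), of t] power2_eq_square)
    have "((\<lambda>t. real k * ?T t / (?G t)\<^sup>2) has_real_derivative
        ((real k * (?r t / t)) * (?G t)\<^sup>2 - real k * ?T t * (2 * (?A t / t) * ?G t))
          / ((?G t)\<^sup>2 * (?G t)\<^sup>2)) (at t)"
      using G0 by (auto intro!: derivative_eq_intros DG DT simp: mult_ac)
    also have "((real k * (?r t / t)) * (?G t)\<^sup>2 - real k * ?T t * (2 * (?A t / t) * ?G t))
          / ((?G t)\<^sup>2 * (?G t)\<^sup>2)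
        = real k * (?G t * ?r t - 2 * ?T t * ?A t) / (t * ?G t ^ 3)"
      using G0 \<open>t \<noteq> 0\<close> by (simp add: divide_simps) (simp add: power_def algebra_simps numeral_eq_Suc)
    finally show "((\<lambda>t. real k * ?T t / (?G t)\<^sup>2) has_real_derivative
        real k * (?G t * ?r t - 2 * ?T t * ?A t) / (t * ?G t ^ 3)) (at t)" .
    show "0 \<le> real k * (?G t * ?r t - 2 * ?T t * ?A t) / (t * ?G t ^ 3)"
      using t G [OF t] lower_mean_upper_tail_le [of t k n] k by simp
  qed simp
qed

theorem theorem9:
  fixes k n :: nat and \<tau>lo \<tau>hi :: real
  assumes "k \<ge> 1" and "n > k"
    and "\<tau>lo \<in> {0<..1}" and "\<tau>hi \<in> {0<..1}" and "\<tau>lo < \<tau>hi"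
  shows "\<exists>\<tau>\<in>{\<tau>lo..\<tau>hi}. \<forall>q\<in>{0<..1}.
    (\<Sum>i=1..n. \<Sum>l=1..k. min (slots_y k \<tau> l i) (q * slots_x k \<tau> l i))
      \<ge> 1 / 2 * ((\<Sum>i=1..n. \<Sum>l=1..k. min (slots_y k \<tau>lo l i) (q * slots_x k \<tau>lo l i))
               + (\<Sum>i=1..n. \<Sum>l=1..k. min (slots_y k \<tau>hi l i) (q * slots_x k \<tau>hi l i)))"
proof -
  let ?S = "slots_sum n k"
  define Sa Sb where "Sa = ?S \<tau>lo" and "Sb = ?S \<tau>hi"
  have pos: "0 < Sa" "0 < Sb"
    using assms by (simp_all add: Sa_def Sb_def slots_sum_pos)
  define \<mu> where "\<mu> = Sb / (Sa + Sb)"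
  have \<mu>: "0 \<le> \<mu>" "\<mu> \<le> 1" "1 - \<mu> = Sa / (Sa + Sb)"
    using pos by (simp_all add: \<mu>_def field_simps)
  define \<tau> where "\<tau> = (1 - \<mu>) * \<tau>lo + \<mu> * \<tau>hi"
  have \<tau>_eq: "\<tau> * (Sa + Sb) = \<tau>lo * Sa + \<tau>hi * Sb"
  proof -
    have "(1 - \<mu>) * (Sa + Sb) = Sa" "\<mu> * (Sa + Sb) = Sb"
      using pos unfolding \<mu>(3) by (simp_all add: \<mu>_def)
    then show ?thesis
      unfolding \<tau>_def by (metis distrib_right mult.assoc mult.commute)
  qed
  have "\<tau> - \<tau>lo = \<mu> * (\<tau>hi - \<tau>lo)" "\<tau>hi - \<tau> = (1 - \<mu>) * (\<tau>hi - \<tau>lo)"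
    by (simp_all add: \<tau>_def algebra_simps)
  moreover have "0 \<le> \<mu> * (\<tau>hi - \<tau>lo)" "0 \<le> (1 - \<mu>) * (\<tau>hi - \<tau>lo)"
    using \<mu>(1,2) assms(5) by simp_all
  ultimately have \<tau>: "\<tau>lo \<le> \<tau>" "\<tau> \<le> \<tau>hi" by (metis diff_ge_0_iff_ge)+
  then have \<tau>01: "0 < \<tau>" "\<tau> \<le> 1" using assms by auto
  have S\<tau>: "0 < ?S \<tau>" using \<tau>01 assms by (simp add: slots_sum_pos)
  \<comment> \<open>Convexity at \<open>\<tau>\<close>; the weights are proportional to
    \<open>Sa\<close> and \<open>Sb\<close>, so the two reciprocals contribute equally.\<close>
  have "1 / ?S \<tau> \<le> (1 - \<mu>) * (1 / Sa) + \<mu> * (1 / Sb)"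
    using convex_onD [OF convex_divide_capped_mean [OF assms(1,2)] \<mu>(1,2) assms(3,4)]
    using \<tau>01 assms by (simp add: \<tau>_def [symmetric] Sa_def Sb_def capped_mean_eq_slots_sum)
  also have "\<dots> = 2 / (Sa + Sb)"
    using pos unfolding \<mu>(3) by (simp add: \<mu>_def field_simps)
  finally have S: "Sa + Sb \<le> 2 * ?S \<tau>"
    using pos S\<tau> by (simp add: field_simps)
  have "min \<tau>lo q * Sa + min \<tau>hi q * Sb \<le> 2 * (min \<tau> q * ?S \<tau>)" if "0 < q" for q
  \<comment> \<open>The value of \<open>min \<tau> q\<close> decides whether both other minima are
    bounded by \<open>q\<close> or by their end points.\<close>
  proof (cases "q \<le> \<tau>")
    case True
    have "min \<tau>lo q * Sa + min \<tau>hi q * Sb \<le> q * Sa + q * Sb"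
      using pos by (intro add_mono mult_right_mono) auto
    also have "\<dots> \<le> q * (2 * ?S \<tau>)"
      using S that by (simp add: distrib_left [symmetric])
    finally show ?thesis using True by simp
  next
    case False
    have "min \<tau>lo q * Sa + min \<tau>hi q * Sb \<le> \<tau>lo * Sa + \<tau>hi * Sb"
      using pos by (intro add_mono mult_right_mono) auto
    also have "\<dots> \<le> \<tau> * (2 * ?S \<tau>)"
      using S \<tau>01 by (simp add: \<tau>_eq [symmetric])
    finally show ?thesis using False by simp
  qed
  moreover have "0 \<le> \<tau>lo" "\<tau>lo \<le> 1" "0 \<le> \<tau>hi" "\<tau>hi \<le> 1" "0 \<le> \<tau>"
    using assms(3,4) \<tau>01 by auto
  ultimately show ?thesis
    using \<tau> \<tau>01(2)
    by (intro bexI [of _ \<tau>]) (simp_all only: sum_min_slots, simp_all add: Sa_def Sb_def mult.commute [of 2])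
qed

end
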